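(* Let $m\le n$ and let $Q\in\mathbb{R}^{m\times n}$ with $QQ^T=I$ have the block form $Q=\begin{bmatrix}A & O\\ B & C\end{bmatrix}$, where $B$ is nowhere zero and both $A$ and $C$ have the strong inner product property. Then $Q$ has the strong inner product property.
   Context: All matrices are real; $\circ$ denotes the Hadamard product; a matrix is nowhere zero if all of its entries are nonzero. A matrix $M\in\mathbb{R}^{k\times l}$ with $k\le l$ has the strong inner product property (SIPP) if $M$ has rank $k$ and $X=O$ is the only symmetric $k\times k$ matrix $X$ with $(XM)\circ M=O$. *)

theory Defs
  imports "Jordan_Normal_Form.DL_Rank"
begin

definition hadamard_prod :: "'a::times mat \<Rightarrow> 'a mat \<Rightarrow> 'a mat" (infixl "\<circ>\<^sub>H" 70) where
  "M \<circ>\<^sub>H N = mat (dim_row M) (dim_col M) (\<lambda>(i, j). M $$ (i, j) * N $$ (i, j))"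

definition nowhere_zero :: "'a::zero mat \<Rightarrow> bool" where
  "nowhere_zero M \<longleftrightarrow> (\<forall>i < dim_row M. \<forall>j < dim_col M. M $$ (i, j) \<noteq> 0)"

definition symmetric_mat :: "'a mat \<Rightarrow> bool" where
  "symmetric_mat X \<longleftrightarrow> X\<^sup>T = X"

text \<open>Strong inner product property. The first argument of \<^const>\<open>vec_space.rank\<close> is the
  dimension of the space containing the columns, i.e. the number of rows.\<close>

definition SIPP :: "real mat \<Rightarrow> bool" where
  "SIPP M \<longleftrightarrow>
     (let k = dim_row M; l = dim_col M in
        k \<le> l \<and> vec_space.rank k M = k \<and>
        (\<forall>X \<in> carrier_mat k k.
           symmetric_mat X \<and> (X * M) \<circ>\<^sub>H M = 0\<^sub>m k l \<longrightarrow> X = 0\<^sub>m k k))"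

end

theory Submission
  imports Defs
begin

text \<open>Write a symmetric matrix \<open>X\<close> with \<open>(X Q) \<circ> Q = O\<close> in blocks \<open>X\<^sub>1, Y, Y\<^sup>T, Z\<close>.
  The lower right block of \<open>X Q\<close> is \<open>Z C\<close>, so \<open>Z = O\<close> because \<open>C\<close> has the SIPP. The lower left
  block \<open>Y\<^sup>T A + Z B = Y\<^sup>T A\<close> vanishes because \<open>B\<close> is nowhere zero, and multiplying by
  \<open>A\<^sup>T\<close> gives \<open>Y = O\<close>, as \<open>A A\<^sup>T = I\<close>. Then the upper left block is \<open>X\<^sub>1 A\<close>, so \<open>X\<^sub>1 = O\<close>
  because \<open>A\<close> has the SIPP.\<close>

text \<open>Lets a block equation be read componentwise. The shared sizes fix where the blocks meet,
  so each block is recovered by evaluating at indices shifted by \<open>nr1\<close> or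
  \<open>nc1\<close>.\<close>

lemma four_block_mat_eq_iff:
  assumes "A1 \<in> carrier_mat nr1 nc1" "B1 \<in> carrier_mat nr1 nc2"
    "C1 \<in> carrier_mat nr2 nc1" "D1 \<in> carrier_mat nr2 nc2"
    and "A2 \<in> carrier_mat nr1 nc1" "B2 \<in> carrier_mat nr1 nc2"
    "C2 \<in> carrier_mat nr2 nc1" "D2 \<in> carrier_mat nr2 nc2"
  shows "four_block_mat A1 B1 C1 D1 = four_block_mat A2 B2 C2 D2 \<longleftrightarrow>
    A1 = A2 \<and> B1 = B2 \<and> C1 = C2 \<and> D1 = D2" (is "?M = ?N \<longleftrightarrow> _")
proof
  assume eq: "?M = ?N"
  have "A1 $$ (i, j) = A2 $$ (i, j)" if "i < nr1" "j < nc1" for i j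
    using arg_cong[OF eq, of "\<lambda>M. M $$ (i, j)"] assms that by auto
  moreover have "B1 $$ (i, j) = B2 $$ (i, j)" if "i < nr1" "j < nc2" for i j
    using arg_cong[OF eq, of "\<lambda>M. M $$ (i, nc1 + j)"] assms that by auto
  moreover have "C1 $$ (i, j) = C2 $$ (i, j)" if "i < nr2" "j < nc1" for i j
    using arg_cong[OF eq, of "\<lambda>M. M $$ (nr1 + i, j)"] assms that by auto
  moreover have "D1 $$ (i, j) = D2 $$ (i, j)" if "i < nr2" "j < nc2" for i j
    using arg_cong[OF eq, of "\<lambda>M. M $$ (nr1 + i, nc1 + j)"] assms that by auto
  ultimately show "A1 = A2 \<and> B1 = B2 \<and> C1 = C2 \<and> D1 = D2"
    using assms by (intro conjI eq_matI) auto
qed simp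

lemma hadamard_prod_carrier [simp, intro]:
  "M \<in> carrier_mat nr nc \<Longrightarrow> M \<circ>\<^sub>H N \<in> carrier_mat nr nc"
  by (simp add: hadamard_prod_def)

lemma hadamard_prod_four_block_mat:
  assumes "A1 \<in> carrier_mat nr1 nc1" "B1 \<in> carrier_mat nr1 nc2"
    "C1 \<in> carrier_mat nr2 nc1" "D1 \<in> carrier_mat nr2 nc2"
    and "A2 \<in> carrier_mat nr1 nc1" "B2 \<in> carrier_mat nr1 nc2"
    "C2 \<in> carrier_mat nr2 nc1" "D2 \<in> carrier_mat nr2 nc2"
  shows "four_block_mat A1 B1 C1 D1 \<circ>\<^sub>H four_block_mat A2 B2 C2 D2 =
    four_block_mat (A1 \<circ>\<^sub>H A2) (B1 \<circ>\<^sub>H B2) (C1 \<circ>\<^sub>H C2) (D1 \<circ>\<^sub>H D2)"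
  using assms by (intro eq_matI) (auto simp: hadamard_prod_def)

lemma hadamard_prod_nowhere_zero_eq_0:
  fixes M N :: "'a::semiring_no_zero_divisors mat"
  assumes "M \<in> carrier_mat nr nc" "N \<in> carrier_mat nr nc"
    and "nowhere_zero N" "M \<circ>\<^sub>H N = 0\<^sub>m nr nc"
  shows "M = 0\<^sub>m nr nc"
proof (rule eq_matI)
  fix i j assume "i < dim_row (0\<^sub>m nr nc :: 'a mat)" "j < dim_col (0\<^sub>m nr nc :: 'a mat)"
  then show "M $$ (i, j) = 0\<^sub>m nr nc $$ (i, j)"
    using arg_cong[OF assms(4), of "\<lambda>M. M $$ (i, j)"] assms(1-3)
    by (auto simp: hadamard_prod_def nowhere_zero_def)
qed (use assms in auto)

text \<open>A right inverse makes \<open>A\<close> surjective, since \<open>y = A (B y)\<close>;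
  hence the columns span the whole space. With \<open>Q\<^sup>T\<close> as right inverse this yields
  the rank part of the SIPP.\<close>

lemma (in vec_space) rank_right_invertible:
  assumes A: "A \<in> carrier_mat n nc" and B: "B \<in> carrier_mat nc n" and "A * B = 1\<^sub>m n"
  shows "rank A = n"
proof -
  have "\<exists>x\<in>carrier_vec nc. A *\<^sub>v x = y" if "y \<in> carrier_vec n" for y
    using that A B assoc_mult_mat_vec[OF A B that] assms(3)
    by (intro bexI[of _ "B *\<^sub>v y"]) auto
  then have span: "span (set (cols A)) = carrier_vec n"
    using A col_space_eq[OF A] by (auto simp: col_space_def)
  \<comment> \<open>The rank is the dimension of the column span viewed as a space of its own; here
    that space is the ambient \<open>V\<close>, of dimension \<open>n\<close>.\<close>
  have "vs (carrier_vec n) = V"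
    by (simp add: module_vec_def)
  then show ?thesis
    unfolding rank_def span by (rule ssubst) (rule dim_is_n)
qed

lemma SIPP_D:
  assumes "SIPP M" "M \<in> carrier_mat k l" "X \<in> carrier_mat k k" "X\<^sup>T = X"
    and "(X * M) \<circ>\<^sub>H M = 0\<^sub>m k l"
  shows "X = 0\<^sub>m k k"
  using assms by (auto simp: SIPP_def symmetric_mat_def Let_def)

theorem proposition5p5:
  fixes m n p q r s :: nat and Q A B C :: "real mat"
  assumes "m \<le> n"
    and "Q \<in> carrier_mat m n"
    and "Q * Q\<^sup>T = 1\<^sub>m m"
    and "A \<in> carrier_mat p r" and "B \<in> carrier_mat q r" and "C \<in> carrier_mat q s"
    and "Q = four_block_mat A (0\<^sub>m p s) B C"
    and "nowhere_zero B"
    and "SIPP A" and "SIPP C"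
  shows "SIPP Q"
proof -
  note A = assms(4) and B = assms(5) and C = assms(6) and Q = assms(7)
  have m: "m = p + q" and n: "n = r + s"
    using assms(2) A C Q by auto
  have "Q * Q\<^sup>T = four_block_mat (A * A\<^sup>T + 0\<^sub>m p s * (0\<^sub>m p s)\<^sup>T) (A * B\<^sup>T + 0\<^sub>m p s * C\<^sup>T)
      (B * A\<^sup>T + C * (0\<^sub>m p s)\<^sup>T) (B * B\<^sup>T + C * C\<^sup>T)"
    unfolding Q transpose_four_block_mat[OF A zero_carrier_mat B C]
    by (rule mult_four_block_mat) (use A B C in auto)
  \<comment> \<open>Both equations have the same left side, so the chain equates the two block
    forms; their upper left blocks then give \<open>A * A\<^sup>T = 1\<^sub>m p\<close>.\<close>
  also have "Q * Q\<^sup>T = four_block_mat (1\<^sub>m p) (0\<^sub>m p q) (0\<^sub>m q p) (1\<^sub>m q)"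
    using assms(3) m by simp
  finally have "A * A\<^sup>T + 0\<^sub>m p s * (0\<^sub>m p s)\<^sup>T = 1\<^sub>m p"
    by (subst (asm) four_block_mat_eq_iff[of _ p p _ q _ q]) (use A B C in auto)
  then have AAT: "A * A\<^sup>T = 1\<^sub>m p"
    using A by simp
  have "X = 0\<^sub>m m m"
    if X: "X \<in> carrier_mat m m" and sym: "X\<^sup>T = X" and XQ: "(X * Q) \<circ>\<^sub>H Q = 0\<^sub>m m n" for X
  proof -
    obtain X1 Y W Z where split: "split_block X p p = (X1, Y, W, Z)"
      by (cases "split_block X p p")
    note blocks = split_block[OF split, of q q]
    have X1: "X1 \<in> carrier_mat p p" and Y: "Y \<in> carrier_mat p q" and W: "W \<in> carrier_mat q p"
      and Z: "Z \<in> carrier_mat q q" and X_eq: "X = four_block_mat X1 Y W Z"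
      using blocks X m by auto
    \<comment> \<open>Transposition swaps the off-diagonal blocks, so symmetry of \<open>X\<close>
      ties \<open>W\<close> to \<open>Y\<close> and makes both diagonal blocks symmetric, as
      \<open>SIPP_D\<close> requires.\<close>
    have "four_block_mat X1\<^sup>T W\<^sup>T Y\<^sup>T Z\<^sup>T = four_block_mat X1 Y W Z"
      using sym transpose_four_block_mat[OF X1 Y W Z] X_eq by simp
    then have X1_sym: "X1\<^sup>T = X1" and Y_eq: "W\<^sup>T = Y" and Z_sym: "Z\<^sup>T = Z"
      by (subst (asm) four_block_mat_eq_iff[of _ p p _ q _ q]; use X1 Y W Z in auto)+
    have "X * Q = four_block_mat (X1 * A + Y * B) (X1 * 0\<^sub>m p s + Y * C)
        (W * A + Z * B) (W * 0\<^sub>m p s + Z * C)"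
      unfolding X_eq Q by (rule mult_four_block_mat) (use X1 Y W Z A B C in auto)
    then have XQ_blocks: "(X * Q) \<circ>\<^sub>H Q = four_block_mat ((X1 * A + Y * B) \<circ>\<^sub>H A)
        ((X1 * 0\<^sub>m p s + Y * C) \<circ>\<^sub>H 0\<^sub>m p s) ((W * A + Z * B) \<circ>\<^sub>H B) ((W * 0\<^sub>m p s + Z * C) \<circ>\<^sub>H C)"
      using X1 Y W Z A B C unfolding Q
      by (simp add: hadamard_prod_four_block_mat[of _ p r _ s _ q])
    have "(X * Q) \<circ>\<^sub>H Q = four_block_mat (0\<^sub>m p r) (0\<^sub>m p s) (0\<^sub>m q r) (0\<^sub>m q s)"
      using XQ m n by simp
    from trans[OF XQ_blocks[symmetric] this]
    have "(X1 * A + Y * B) \<circ>\<^sub>H A = 0\<^sub>m p r \<and>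
        (X1 * 0\<^sub>m p s + Y * C) \<circ>\<^sub>H 0\<^sub>m p s = 0\<^sub>m p s \<and>
        (W * A + Z * B) \<circ>\<^sub>H B = 0\<^sub>m q r \<and> (W * 0\<^sub>m p s + Z * C) \<circ>\<^sub>H C = 0\<^sub>m q s"
      \<comment> \<open>The rotation moves the eight carrier premises behind the block equation, so
        that the chained fact matches the first premise.\<close>
      by (rule iffD1[OF four_block_mat_eq_iff[of _ p r _ s _ q], rotated 8])
         (use X1 Y W Z A B C in auto)
    then have UL: "(X1 * A + Y * B) \<circ>\<^sub>H A = 0\<^sub>m p r"
      and LL: "(W * A + Z * B) \<circ>\<^sub>H B = 0\<^sub>m q r"
      and LR: "(W * 0\<^sub>m p s + Z * C) \<circ>\<^sub>H C = 0\<^sub>m q s"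
      by blast+
    \<comment> \<open>The order matters: the lower left block mixes \<open>W\<close> with
      \<open>Z\<close>, and the upper left block mixes \<open>X1\<close> with \<open>Y\<close>. Only
      the lower right block isolates an unknown at once.\<close>
    have Z0: "Z = 0\<^sub>m q q"
      using SIPP_D[OF assms(10) C Z Z_sym] LR W Z C by simp
    have "W * A + Z * B = 0\<^sub>m q r"
      by (rule hadamard_prod_nowhere_zero_eq_0[OF _ B assms(8) LL]) (use W Z A B in auto)
    then have "W * A = 0\<^sub>m q r"
      using Z0 W A B by simp
    then have "W * (A * A\<^sup>T) = 0\<^sub>m q p"
      using assoc_mult_mat[OF W A, of "A\<^sup>T" p] A by simp
    then have W0: "W = 0\<^sub>m q p"
      using AAT W by simp
    then have Y0: "Y = 0\<^sub>m p q"
      using Y_eq by simp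
    have "X1 = 0\<^sub>m p p"
      using SIPP_D[OF assms(9) A X1 X1_sym] UL Y0 X1 A B by simp
    then show ?thesis
      using X_eq Y0 W0 Z0 m by simp
  qed
  \<comment> \<open>Full row rank comes from \<open>Q * Q\<^sup>T = 1\<^sub>m m\<close>,
    independently of the block structure.\<close>
  moreover have "vec_space.rank m Q = m"
    using vec_space.rank_right_invertible[OF assms(2) _ assms(3)] assms(2) by simp
  ultimately show ?thesis
    using assms(1,2) by (auto simp: SIPP_def symmetric_mat_def Let_def)
qed

end
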